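(* Let $\epsilon\in(0,1)$ and let $F=(f_n)_{n\ge1}$ be any sequence of positive integers for which $f_n=\sum_{i\le\epsilon n}f_i$ for all sufficiently large $n$. Then every $\epsilon$-complete sequence $A=(a_n)_{n\ge1}$ (listed in increasing order) satisfies $a_n=O(f_n)$, and there is an $\epsilon$-complete sequence $A=(a_n)_{n\ge1}$ with $a_n=\Theta(f_n)$.
   Context: For a sequence $A$ of positive integers, $\Sigma(A)$ is the set of integers representable as a sum of distinct terms of $A$; $A$ is complete if every sufficiently large positive integer lies in $\Sigma(A)$. A sequence $A$ of positive integers is $\epsilon$-complete if every subsequence $A'$ of $A$ with $|A'\cap[n]|\ge\epsilon|A\cap[n]|$ for all sufficiently large $n$ is complete. Here $[n]=\{1,\dots,n\}$. *)

theory Defs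
  imports Complex_Main "HOL-Library.Infinite_Set" "HOL-Library.Landau_Symbols"
begin

text \<open>A sequence of positive integers listed in increasing order is represented
  by its set of terms, a set of positive naturals.  Its n-th term (1-based) is
  \<open>enumerate A (n - 1)\<close>.\<close>

definition subset_sums :: "nat set \<Rightarrow> nat set" where
  "subset_sums A = {\<Sum>B | B. B \<subseteq> A \<and> finite B}"

definition complete_seq :: "nat set \<Rightarrow> bool" where
  "complete_seq A \<longleftrightarrow> (\<exists>N. \<forall>m\<ge>N. m \<in> subset_sums A)"

definition eps_complete :: "real \<Rightarrow> nat set \<Rightarrow> bool" where
  "eps_complete \<epsilon> A \<longleftrightarrow>
     (\<forall>A'. A' \<subseteq> A \<longrightarrow>
        (\<exists>N. \<forall>n\<ge>N. real (card (A' \<inter> {1..n})) \<ge> \<epsilon> * real (card (A \<inter> {1..n})))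
        \<longrightarrow> complete_seq A')"

end

theory Submission
  imports Defs "HOL-Number_Theory.Cong"
begin

text \<open>
  Upper bound: if \<open>a n\<close> exceeds the sum of the first \<open>\<epsilon> n + C\<close> terms for infinitely many \<open>n\<close>
  and every \<open>C\<close>, then one can delete the terms just below a sparse sequence of such \<open>a n\<close>,
  keep density \<open>\<epsilon>\<close>, and still miss a number below each of them. Hence
  \<open>a n\<close> is at most the sum of the first \<open>\<epsilon> n + C\<close> terms, and comparing with the recurrence
  shifted by a constant gives \<open>a n = O(f n)\<close>.

  Construction: up to a factor and a linear term, \<open>a n\<close> is \<open>f (n + d n)\<close> with \<open>n\<close> rounded down to a
  multiple of \<open>w > 1 / \<epsilon>\<close>, where \<open>d\<close> tends to infinity so slowly that
  \<open>f (n + d n) = O(f n)\<close>. The shift makes \<open>a n\<close> at most the sum of the first \<open>\<epsilon> n - c\<close> terms for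
  every constant \<open>c\<close> and all large \<open>n\<close>, so that finitely many terms of a subsequence of density \<open>\<epsilon>\<close>
  can be set aside to represent a long interval, which the remaining terms then extend to infinity.
\<close>

section \<open>Subset sums and intervals of represented numbers\<close>

lemma sum_lessThan_card_le:
  fixes a :: "nat \<Rightarrow> nat"
  assumes "mono a" "finite C"
  shows "(\<Sum>i<card C. a i) \<le> (\<Sum>i\<in>C. a i)"
  using assms(2)
proof (induction "card C" arbitrary: C)
  case (Suc n)
  then have ne: "C \<noteq> {}" by auto
  define m where "m = Max C"
  have m: "m \<in> C" using Suc ne by (simp add: m_def)
  have "C \<subseteq> {..m}" using Suc by (auto simp: m_def)
  then have "card C \<le> Suc m" using card_mono[of "{..m}" C] by simp
  then have "n \<le> m" using Suc by simp
  have "n = card (C - {m})" using Suc m by simp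
  then have "(\<Sum>i<n. a i) \<le> (\<Sum>i\<in>C-{m}. a i)"
    using Suc by (metis finite_Diff)
  moreover have "a n \<le> a m" using \<open>n \<le> m\<close> assms(1) by (simp add: monoD)
  moreover have "(\<Sum>i\<in>C. a i) = a m + (\<Sum>i\<in>C-{m}. a i)"
    using Suc m by (simp add: sum.remove)
  ultimately show ?case using Suc(2) by (metis add.commute add_mono sum.lessThan_Suc)
qed simp

lemma subset_sums_mono: "A \<subseteq> B \<Longrightarrow> subset_sums A \<subseteq> subset_sums B"
  unfolding subset_sums_def by blast

lemma subset_sums_union:
  assumes "x \<in> subset_sums A" "y \<in> subset_sums B" "A \<inter> B = {}"
  shows "x + y \<in> subset_sums (A \<union> B)"
proof -
  obtain U V where "x = \<Sum>U" "U \<subseteq> A" "finite U" "y = \<Sum>V" "V \<subseteq> B" "finite V"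
    using assms unfolding subset_sums_def by auto
  moreover from this have "\<Sum>(U \<union> V) = \<Sum>U + \<Sum>V"
    using assms(3) by (intro sum.union_disjoint) auto
  ultimately have "x + y = \<Sum>(U \<union> V) \<and> U \<union> V \<subseteq> A \<union> B \<and> finite (U \<union> V)" by auto
  then show ?thesis unfolding subset_sums_def by blast
qed

lemma singleton_mem_subset_sums: "x \<in> subset_sums {x}"
  unfolding subset_sums_def by (auto intro!: exI[of _ "{x}"])

text \<open>Adjoin the terms of \<open>H\<close> in increasing order. Each new \<open>h\<close> is
  at most the length of the interval represented so far, so this interval and its translate by
  \<open>h\<close> overlap and merge into one that is longer by \<open>h\<close>.\<close>

lemma complete_seq_extend_interval:
  fixes H V :: "nat set"
  assumes base: "{L..L+Z} \<subseteq> subset_sums V"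
    and disj: "V \<inter> H = {}" and inf: "infinite H"
    and step: "\<And>h. h \<in> H \<Longrightarrow> h \<le> Z + \<Sum>{h'\<in>H. h' < h}"
  shows "complete_seq (V \<union> H)"
proof -
  have cov: "{L..L + Z + \<Sum>{h\<in>H. h < T}} \<subseteq> subset_sums (V \<union> {h\<in>H. h < T})" for T
  proof (induction T)
    case 0
    then show ?case using base by simp
  next
    case (Suc T)
    show ?case
    proof (cases "T \<in> H")
      case False
      then have "{h\<in>H. h < Suc T} = {h\<in>H. h < T}" by (auto simp: less_Suc_eq)
      then show ?thesis using Suc by simp
    next
      case True
      define HT where "HT = {h\<in>H. h < T}"
      have eq: "{h\<in>H. h < Suc T} = insert T HT" using True by (auto simp: less_Suc_eq HT_def)
      have fin: "finite HT" by (simp add: HT_def)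
      have sum: "\<Sum>{h\<in>H. h < Suc T} = T + \<Sum>HT" unfolding eq using fin by (simp add: HT_def)
      have IH: "{L..L + Z + \<Sum>HT} \<subseteq> subset_sums (V \<union> HT)" using Suc by (simp add: HT_def)
      have T: "T \<le> Z + \<Sum>HT" using step[OF True] by (simp add: HT_def)
      show ?thesis
      proof
        fix x assume x: "x \<in> {L..L + Z + \<Sum>{h\<in>H. h < Suc T}}"
        show "x \<in> subset_sums (V \<union> {h\<in>H. h < Suc T})"
        proof (cases "x \<le> L + Z + \<Sum>HT")
          case True
          then have "x \<in> subset_sums (V \<union> HT)" using IH x by auto
          then show ?thesis using subset_sums_mono[of "V \<union> HT" "V \<union> {h\<in>H. h < Suc T}"] eq by blast
        next
          case False
          then have "x - T \<in> {L..L + Z + \<Sum>HT}" using x T sum by auto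
          then have "x - T \<in> subset_sums (V \<union> HT)" using IH by blast
          then have "(x - T) + T \<in> subset_sums ((V \<union> HT) \<union> {T})"
            by (rule subset_sums_union[OF _ singleton_mem_subset_sums])
               (use True disj in \<open>auto simp: HT_def\<close>)
          then show ?thesis using eq False T by (simp add: Un_assoc)
        qed
      qed
    qed
  qed
  have "x \<in> subset_sums (V \<union> H)" if "L \<le> x" for x
  proof -
    obtain h where h: "h \<in> H" "x \<le> h" using inf by (meson infinite_nat_iff_unbounded_le)
    have "h \<le> \<Sum>{h'\<in>H. h' < Suc h}" using h by (intro member_le_sum) auto
    then have "x \<in> subset_sums (V \<union> {h'\<in>H. h' < Suc h})" using cov[of "Suc h"] h that by auto
    then show ?thesis using subset_sums_mono[of "V \<union> {h'\<in>H. h' < Suc h}" "V \<union> H"] by blast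
  qed
  then show ?thesis unfolding complete_seq_def by blast
qed

text \<open>A \<open>j\<close>-element subset of \<open>R\<close> has sum congruent to
  \<open>r * j\<close>; as \<open>r\<close> is invertible modulo \<open>d\<close>, the sizes
  \<open>j < d\<close> already reach every residue.\<close>

lemma subset_sum_with_residue:
  fixes R :: "nat set"
  assumes "d > 0" "finite R" "card R = d" "\<And>x. x \<in> R \<Longrightarrow> [x = r] (mod d)" "coprime r d"
  obtains Q where "Q \<subseteq> R" "[\<Sum>Q = y] (mod d)"
proof -
  obtain u where u: "[r * u = 1] (mod d)" using cong_solve_coprime_nat[OF assms(5)] by auto
  define j where "j = (u * y) mod d"
  have "j < d" using assms by (simp add: j_def)
  then obtain Q where Q: "Q \<subseteq> R" "card Q = j"
    using obtain_subset_with_card_n[of j R] assms by auto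
  have "[\<Sum>Q = (\<Sum>x\<in>Q. r)] (mod d)"
    by (rule cong_sum) (use Q assms in auto)
  also have "(\<Sum>x\<in>Q. r) = r * j" using Q by simp
  also have "[r * j = r * (u * y)] (mod d)" unfolding j_def by (intro cong_mult) (auto simp: cong_def)
  also have "[r * (u * y) = y] (mod d)" using cong_scalar_right[OF u, of y] by (simp add: mult.assoc)
  finally show ?thesis using that Q by blast
qed

text \<open>Replacing \<open>x\<close> by \<open>x + d\<close> in \<open>k\<close> of the pairs
  raises the sum by \<open>k * d\<close>. A subset \<open>Q\<close> of \<open>R\<close> first
  corrects the residue modulo \<open>d\<close>; its sum can be as large as \<open>\<Sum>R\<close>,
  which is why the interval starts at \<open>\<Sum>X + \<Sum>R\<close>.\<close>

lemma interval_in_subset_sums_of_pairs: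
  fixes X R :: "nat set"
  assumes d: "d > 0" and R: "finite R" "card R = d" "\<And>x. x \<in> R \<Longrightarrow> [x = r] (mod d)" "coprime r d"
    and X: "finite X" "X \<inter> (\<lambda>x. x + d) ` X = {}" "(X \<union> (\<lambda>x. x + d) ` X) \<inter> R = {}"
  shows "{\<Sum>X + \<Sum>R..\<Sum>X + card X * d} \<subseteq> subset_sums (X \<union> (\<lambda>x. x + d) ` X \<union> R)"
proof
  fix y assume y: "y \<in> {\<Sum>X + \<Sum>R..\<Sum>X + card X * d}"
  obtain Q where Q: "Q \<subseteq> R" "[\<Sum>Q = y - \<Sum>X] (mod d)"
    using subset_sum_with_residue[OF d R] by blast
  have QR: "\<Sum>Q \<le> \<Sum>R" using Q R by (intro sum_mono2) auto
  then have le: "\<Sum>Q \<le> y - \<Sum>X" using y by auto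
  then have "d dvd (y - \<Sum>X) - \<Sum>Q" using Q cong_altdef_nat by (metis cong_sym)
  then obtain k where k: "(y - \<Sum>X) - \<Sum>Q = d * k" by auto
  have "d * k \<le> card X * d" unfolding k[symmetric] using y by auto
  then have "k \<le> card X" using d by simp
  then obtain Y where Y: "Y \<subseteq> X" "card Y = k" using obtain_subset_with_card_n X(1) by blast
  have finY: "finite Y" using Y X finite_subset by auto
  define U where "U = (X - Y) \<union> (\<lambda>x. x + d) ` Y"
  have "\<Sum>U = \<Sum>(X - Y) + \<Sum>((\<lambda>x. x + d) ` Y)"
    unfolding U_def using X Y finY by (intro sum.union_disjoint) auto
  also have "\<Sum>((\<lambda>x. x + d) ` Y) = (\<Sum>x\<in>Y. x + d)"
    by (subst sum.reindex) (auto simp: inj_on_def)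
  also have "\<dots> = \<Sum>Y + k * d" using Y by (simp add: sum.distrib)
  also have "\<Sum>(X - Y) + (\<Sum>Y + k * d) = \<Sum>X + k * d"
    using sum.subset_diff[OF Y(1) X(1), of "\<lambda>x. x"] by simp
  finally have "\<Sum>U + \<Sum>Q = y" using k le y by (auto simp: mult.commute)
  moreover have "\<Sum>U \<in> subset_sums (X \<union> (\<lambda>x. x + d) ` X)"
  proof -
    have "U \<subseteq> X \<union> (\<lambda>x. x + d) ` X" "finite U" using X finY Y by (auto simp: U_def)
    then show ?thesis unfolding subset_sums_def by blast
  qed
  moreover have "\<Sum>Q \<in> subset_sums R"
    unfolding subset_sums_def using Q R finite_subset by blast
  ultimately show "y \<in> subset_sums (X \<union> (\<lambda>x. x + d) ` X \<union> R)"
    using subset_sums_union[OF _ _ X(3)] by blast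
qed

lemma downward_closed_eq_lessThan_card:
  fixes S :: "nat set"
  assumes "finite S" "\<And>i j. i \<in> S \<Longrightarrow> j \<le> i \<Longrightarrow> j \<in> S"
  shows "S = {..<card S}"
proof -
  define m where "m = (LEAST m. m \<notin> S)"
  have "m \<notin> S" unfolding m_def using ex_new_if_finite[OF infinite_UNIV_nat assms(1)] by (metis LeastI)
  moreover have "i \<in> S" if "i < m" for i using that not_less_Least unfolding m_def by blast
  ultimately have "S = {..<m}" using assms(2) by (auto simp: not_less[symmetric])
  then show ?thesis by simp
qed

section \<open>Growth forced by completeness\<close>

lemma finite_not_complete_seq:
  assumes "finite A" shows "\<not> complete_seq A"
proof
  assume "complete_seq A"
  then obtain N where N: "\<And>m. m \<ge> N \<Longrightarrow> m \<in> subset_sums A" unfolding complete_seq_def by blast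
  have "N + Suc (\<Sum>A) \<in> subset_sums A" using N by simp
  then obtain B where "B \<subseteq> A" "N + Suc (\<Sum>A) = \<Sum>B" unfolding subset_sums_def by auto
  moreover from this have "\<Sum>B \<le> \<Sum>A" using assms by (intro sum_mono2) auto
  ultimately show False by simp
qed

lemma eps_complete_imp_infinite:
  assumes "eps_complete \<epsilon> A" "\<epsilon> < 1"
  shows "infinite A"
proof -
  have "\<epsilon> * real (card (A \<inter> {1..n})) \<le> real (card (A \<inter> {1..n}))" for n
    using assms(2) mult_right_mono[of \<epsilon> 1 "real (card (A \<inter> {1..n}))"] by simp
  then have "complete_seq A" using assms(1) unfolding eps_complete_def by blast
  then show ?thesis using finite_not_complete_seq by blast
qed

text \<open>A sum using a term from \<open>b\<close> upwards is at least \<open>b\<close>, hence too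
  large; one using only terms below \<open>b\<close> is at most their total, hence too
  small.\<close>

lemma not_mem_subset_sums_below_gap:
  fixes A :: "nat set"
  assumes "Suc (\<Sum>{x\<in>A. x < b}) < b"
  shows "Suc (\<Sum>{x\<in>A. x < b}) \<notin> subset_sums A"
proof
  assume "Suc (\<Sum>{x\<in>A. x < b}) \<in> subset_sums A"
  then obtain B where B: "B \<subseteq> A" "finite B" "Suc (\<Sum>{x\<in>A. x < b}) = \<Sum>B"
    unfolding subset_sums_def by auto
  show False
  proof (cases "\<exists>x\<in>B. b \<le> x")
    case True
    then obtain x where "x \<in> B" "b \<le> x" by blast
    moreover from this have "x \<le> \<Sum>B" using B by (intro member_le_sum) auto
    ultimately show False using B assms by simp
  next
    case False
    then have "B \<subseteq> {x\<in>A. x < b}" using B by force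
    then have "\<Sum>B \<le> \<Sum>{x\<in>A. x < b}" by (intro sum_mono2) auto
    then show False using B by simp
  qed
qed

lemma image_lessThan_strict_mono:
  fixes a :: "nat \<Rightarrow> nat"
  assumes "strict_mono a"
  shows "{x \<in> a ` B. x < a n} = a ` (B \<inter> {..<n})"
  using assms by (auto simp: strict_mono_less)

lemma image_atMost_strict_mono:
  fixes a :: "nat \<Rightarrow> nat"
  assumes "strict_mono a" "\<And>i. a i \<ge> 1"
  shows "a ` B \<inter> {1..a n} = a ` (B \<inter> {..n})"
  using assms by (auto simp: strict_mono_less_eq)

lemma card_image_strict_mono:
  fixes a :: "nat \<Rightarrow> nat"
  assumes "strict_mono a"
  shows "card (a ` B) = card B"
  using assms by (intro card_image) (auto simp: inj_on_def strict_mono_eq)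

lemma eps_complete_imp_term_le_sum:
  fixes a :: "nat \<Rightarrow> nat" and \<epsilon> :: real
  assumes eps: "0 < \<epsilon>" "\<epsilon> < 1"
    and a: "strict_mono a" "\<And>i. a i \<ge> 1" and cpl: "eps_complete \<epsilon> (range a)"
  shows "\<exists>C N. \<forall>n\<ge>N. a n \<le> (\<Sum>i<nat \<lceil>\<epsilon> * real n\<rceil> + C. a i)"
proof (rule ccontr)
  assume "\<not> ?thesis"
  then have bad: "\<exists>n\<ge>N. a n > (\<Sum>i<nat \<lceil>\<epsilon> * real n\<rceil> + C. a i)" for C N
    by (meson not_le)
  \<comment> \<open>The constant \<open>C\<close> is taken to be \<open>s k + 2\<close>: the part
    \<open>s k\<close> leaves room for a long stretch of kept indices after \<open>s k\<close>, and
    the two extra terms make \<open>a (s (Suc k))\<close> exceed even the successor of the shorter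
    sum.\<close>
  have "\<exists>s. \<forall>k. s k < s (Suc k) \<and> a (s (Suc k)) > (\<Sum>i<nat \<lceil>\<epsilon> * real (s (Suc k))\<rceil> + (s k + 2). a i)"
  proof (rule dependent_nat_choice[where P = "\<lambda>_ _. True", simplified])
    fix x :: nat
    show "\<exists>y>x. (\<Sum>i<nat \<lceil>\<epsilon> * real y\<rceil> + (x + 2). a i) < a y"
      using bad[of "Suc x" "x + 2"] by (auto simp: Suc_le_eq)
  qed
  then obtain s where s: "\<And>k. s k < s (Suc k)"
    and gap: "\<And>k. a (s (Suc k)) > (\<Sum>i<nat \<lceil>\<epsilon> * real (s (Suc k))\<rceil> + (s k + 2). a i)" by blast
  define m where "m k = nat \<lceil>\<epsilon> * real (s (Suc k))\<rceil> + s k" for k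
  have gap': "Suc (\<Sum>i<m k. a i) < a (s (Suc k))" for k
  proof -
    have "(\<Sum>i<m k + 2. a i) = (\<Sum>i<m k. a i) + a (m k) + a (Suc (m k))"
      by simp
    then have "(\<Sum>i<m k. a i) + 2 \<le> (\<Sum>i<m k + 2. a i)" using a(2)[of "m k"] a(2)[of "Suc (m k)"] by linarith
    then show ?thesis using gap[of k] by (simp add: m_def add.assoc)
  qed
  have s_mono: "strict_mono s" using s by (simp add: strict_mono_Suc_iff)
  have ms: "m k \<le> s (Suc k)" for k
  proof (rule ccontr)
    assume "\<not> m k \<le> s (Suc k)"
    then have "a (s (Suc k)) \<le> (\<Sum>i<m k. a i)" by (intro member_le_sum) auto
    then show False using gap'[of k] by simp
  qed
  \<comment> \<open>Delete the indices from \<open>m k\<close> up to \<open>s (Suc k)\<close>. The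
    kept stretch from \<open>s k\<close> to \<open>m k\<close> has
    \<open>nat \<lceil>\<epsilon> * real (s (Suc k))\<rceil>\<close> elements, which alone secures
    the density until the deleted stretch ends.\<close>
  define B where "B = {i. \<forall>k. \<not> (m k \<le> i \<and> i < s (Suc k))}"
  have kept: "{s k..<m k} \<subseteq> B" for k
  proof -
    have "\<not> (m l \<le> i \<and> i < s (Suc l))" if "s k \<le> i" "i < m k" for i l
    proof (cases l k rule: linorder_cases)
      case less
      then have "s (Suc l) \<le> s k" using s_mono by (simp add: strict_mono_less_eq)
      then show ?thesis using that by simp
    next
      case greater
      then have "s (Suc k) \<le> s l" using s_mono by (simp add: strict_mono_less_eq)
      then show ?thesis using that ms[of k] by (auto simp: m_def)
    qed (use that in auto)
    then show ?thesis by (auto simp: B_def)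
  qed
  have density: "real (card (B \<inter> {..<j})) \<ge> \<epsilon> * real j" for j
  proof (induction j)
    case (Suc j)
    show ?case
    proof (cases "j \<in> B")
      case True
      then have "B \<inter> {..<Suc j} = insert j (B \<inter> {..<j})" by (auto simp: less_Suc_eq)
      then have "card (B \<inter> {..<Suc j}) = Suc (card (B \<inter> {..<j}))" by simp
      then show ?thesis using Suc eps by (simp add: algebra_simps)
    next
      case False
      then obtain k where k: "m k \<le> j" "j < s (Suc k)" by (auto simp: B_def)
      have "{s k..<m k} \<subseteq> B \<inter> {..<Suc j}" using kept[of k] k by auto
      then have "card {s k..<m k} \<le> card (B \<inter> {..<Suc j})" by (intro card_mono) auto
      then have "real (nat \<lceil>\<epsilon> * real (s (Suc k))\<rceil>) \<le> real (card (B \<inter> {..<Suc j}))"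
        by (simp add: m_def)
      moreover have "\<epsilon> * real (Suc j) \<le> \<epsilon> * real (s (Suc k))"
        using k eps by (intro mult_left_mono) auto
      ultimately show ?thesis by linarith
    qed
  qed simp
  \<comment> \<open>Counting terms up to \<open>n\<close> becomes counting indices, because the
    indices \<open>i\<close> with \<open>a i \<le> n\<close> form an initial segment.\<close>
  have "real (card (a ` B \<inter> {1..n})) \<ge> \<epsilon> * real (card (range a \<inter> {1..n}))" for n
  proof -
    define j where "j = card (range a \<inter> {1..n})"
    have "{i. a i \<le> n} \<subseteq> {..n}" using strict_mono_imp_increasing[OF a(1)] by (auto intro: le_trans)
    then have fin: "finite {i. a i \<le> n}" using finite_subset by blast
    have *: "a ` C \<inter> {1..n} = a ` (C \<inter> {i. a i \<le> n})" for C using a(2) by auto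
    have "{i. a i \<le> n} = {..<j}"
    proof -
      have dc: "i' \<in> {i. a i \<le> n}" if "i \<in> {i. a i \<le> n}" "i' \<le> i" for i i'
        using that a(1) by (auto simp: strict_mono_less_eq intro: le_trans[of "a i'" "a i"])
      have "{i. a i \<le> n} = {..<card {i. a i \<le> n}}"
        using downward_closed_eq_lessThan_card[OF fin dc] by simp
      moreover have "card {i. a i \<le> n} = j"
        using *[of UNIV] card_image_strict_mono[OF a(1)] by (simp add: j_def)
      ultimately show ?thesis by simp
    qed
    then have "card (a ` B \<inter> {1..n}) = card (B \<inter> {..<j})"
      using *[of B] card_image_strict_mono[OF a(1)] by simp
    then show ?thesis using density[of j] by (simp add: j_def)
  qed
  then have "complete_seq (a ` B)" using cpl unfolding eps_complete_def by blast
  then obtain N where N: "\<And>x. x \<ge> N \<Longrightarrow> x \<in> subset_sums (a ` B)" unfolding complete_seq_def by blast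
  \<comment> \<open>At least \<open>\<epsilon> * s (Suc k) \<ge> \<epsilon> * k \<ge> N\<close>
    terms are kept below \<open>b\<close>, each at least 1, so the missed number lies beyond
    \<open>N\<close>.\<close>
  obtain k where k: "real N / \<epsilon> \<le> real k" using real_arch_simple by blast
  define b where "b = a (s (Suc k))"
  have eq: "{x \<in> a ` B. x < b} = a ` (B \<inter> {..<s (Suc k)})"
    unfolding b_def by (rule image_lessThan_strict_mono[OF a(1)])
  have sum_eq: "\<Sum>{x \<in> a ` B. x < b} = (\<Sum>i\<in>B \<inter> {..<s (Suc k)}. a i)"
    unfolding eq using a(1) by (subst sum.reindex) (auto simp: inj_on_def strict_mono_eq)
  have "B \<inter> {..<s (Suc k)} \<subseteq> {..<m k}" by (auto simp: B_def not_le)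
  then have "\<Sum>{x \<in> a ` B. x < b} \<le> (\<Sum>i<m k. a i)" unfolding sum_eq by (intro sum_mono2) auto
  then have "Suc (\<Sum>{x \<in> a ` B. x < b}) < b" using gap'[of k] by (simp add: b_def)
  then have "Suc (\<Sum>{x \<in> a ` B. x < b}) \<notin> subset_sums (a ` B)"
    by (rule not_mem_subset_sums_below_gap)
  moreover have "N \<le> Suc (\<Sum>{x \<in> a ` B. x < b})"
  proof -
    have "card (B \<inter> {..<s (Suc k)}) \<le> \<Sum>{x \<in> a ` B. x < b}"
      unfolding sum_eq using sum_mono[of "B \<inter> {..<s (Suc k)}" "\<lambda>_. 1" a] a(2) by simp
    moreover have "real N \<le> \<epsilon> * real k" using k eps by (simp add: field_simps)
    moreover have "\<epsilon> * real k \<le> \<epsilon> * real (s (Suc k))"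
      using strict_mono_imp_increasing[OF s_mono, of "Suc k"] eps by (intro mult_left_mono) auto
    moreover have "\<epsilon> * real (s (Suc k)) \<le> real (card (B \<inter> {..<s (Suc k)}))" by (rule density)
    ultimately have "real N \<le> real (\<Sum>{x \<in> a ` B. x < b})" by linarith
    then show ?thesis by (simp only: of_nat_le_iff le_SucI)
  qed
  ultimately show False using N by blast
qed

section \<open>Growth and shifts under the recurrence\<close>

locale fractional_sum_sequence =
  fixes \<epsilon> :: real and f :: "nat \<Rightarrow> nat" and N :: nat
  assumes eps: "0 < \<epsilon>" "\<epsilon> < 1"
    and f_pos: "\<And>n. n \<ge> 1 \<Longrightarrow> f n > 0"
    and f_rec: "\<And>n. n \<ge> N \<Longrightarrow> f n = (\<Sum>i\<in>{1..nat \<lfloor>\<epsilon> * real n\<rfloor>}. f i)"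
begin

definition S :: "nat \<Rightarrow> nat" where "S n = (\<Sum>i\<in>{1..n}. f i)"

text \<open>The right side of the recurrence at every index: it agrees with \<open>f\<close> from
  \<open>N\<close> on and is monotone everywhere, whereas \<open>f\<close> may be irregular below
  \<open>N\<close>.\<close>

definition g :: "nat \<Rightarrow> nat" where "g n = S (nat \<lfloor>\<epsilon> * real n\<rfloor>)"

lemma f_eq_g: "n \<ge> N \<Longrightarrow> f n = g n"
  using f_rec by (simp add: g_def S_def)

lemma S_Suc: "S (Suc n) = S n + f (Suc n)"
  by (simp add: S_def)

lemma S_mono: "m \<le> n \<Longrightarrow> S m \<le> S n"
  unfolding S_def by (intro sum_mono2) auto

lemma g_mono: "m \<le> n \<Longrightarrow> g m \<le> g n"
  unfolding g_def using eps by (intro S_mono nat_mono floor_mono mult_left_mono) auto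

lemma f_mono: "N \<le> m \<Longrightarrow> m \<le> n \<Longrightarrow> f m \<le> f n"
  using f_eq_g g_mono by (metis le_trans)

lemma f_unbounded: "\<forall>\<^sub>F n in sequentially. K \<le> f n"
proof -
  obtain n0 where n0: "real (K + 1) / \<epsilon> \<le> real n0" using real_arch_simple by blast
  have "K \<le> f n" if "n \<ge> max N n0" for n
  proof -
    have "real (K + 1) \<le> \<epsilon> * real n0" using n0 eps by (simp add: field_simps)
    also have "\<dots> \<le> \<epsilon> * real n" using that eps by (intro mult_left_mono) auto
    finally have "K \<le> nat \<lfloor>\<epsilon> * real n\<rfloor>" by linarith
    moreover have "m \<le> S m" for m
      using sum_mono[of "{1..m}" "\<lambda>_. 1" f] f_pos by (force simp: S_def Suc_le_eq)
    ultimately show ?thesis using f_eq_g[of n] that by (auto simp: g_def intro: le_trans)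
  qed
  then show ?thesis unfolding eventually_sequentially by blast
qed

text \<open>For large \<open>n\<close> at least \<open>\<epsilon> * n / 2\<close> summands of
  \<open>f n\<close> have index beyond \<open>n1\<close> and are therefore at least
  \<open>K\<close>, where \<open>K\<close> can be as large as desired.\<close>

lemma f_superlinear: "\<forall>\<^sub>F n in sequentially. c * real n \<le> real (f n)"
proof -
  obtain K :: nat where K: "2 * max c 0 / \<epsilon> \<le> real K" using real_arch_simple by blast
  obtain n1 where n1: "\<And>n. n \<ge> n1 \<Longrightarrow> K \<le> f n"
    using f_unbounded[of K] unfolding eventually_sequentially by blast
  obtain n2 where n2: "2 * (real n1 + 1) / \<epsilon> \<le> real n2" using real_arch_simple by blast
  have "c * real n \<le> real (f n)" if n: "n \<ge> max N n2" for n
  proof -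
    define J where "J = nat \<lfloor>\<epsilon> * real n\<rfloor>"
    have "2 * (real n1 + 1) \<le> \<epsilon> * real n2" using n2 eps by (simp add: field_simps)
    also have "\<dots> \<le> \<epsilon> * real n" using n eps by (intro mult_left_mono) auto
    finally have big: "2 * (real n1 + 1) \<le> \<epsilon> * real n" .
    then have J: "real J \<ge> \<epsilon> * real n - 1" "n1 \<le> J" unfolding J_def by (linarith, simp add: le_nat_floor)
    have "(\<Sum>i\<in>{n1<..J}. K) \<le> (\<Sum>i\<in>{n1<..J}. f i)" by (intro sum_mono n1) auto
    also have "\<dots> \<le> (\<Sum>i\<in>{1..J}. f i)" by (intro sum_mono2) auto
    also have "\<dots> = f n" using f_eq_g[of n] n by (simp add: g_def S_def J_def)
    finally have "(J - n1) * K \<le> f n" by simp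
    then have "real (J - n1) * real K \<le> real (f n)" by (metis of_nat_le_iff of_nat_mult)
    moreover have "\<epsilon> * real n / 2 \<le> real (J - n1)" using J big by (simp add: of_nat_diff)
    ultimately have "\<epsilon> * real n / 2 * real K \<le> real (f n)"
      using mult_right_mono[of "\<epsilon> * real n / 2" "real (J - n1)" "real K"] by linarith
    moreover have "max c 0 \<le> \<epsilon> * real K / 2" using K eps by (simp add: field_simps)
    then have "c \<le> \<epsilon> * real K / 2" by simp
    then have "c * real n \<le> \<epsilon> * real K / 2 * real n" by (intro mult_right_mono) auto
    ultimately show ?thesis by (simp add: mult_ac)
  qed
  then show ?thesis unfolding eventually_sequentially by blast
qed

text \<open>Shifting the argument by \<open>s\<close> extends the range of summation by at most
  \<open>k\<close>. Summing the hypothesis termwise gives the factor \<open>\<mu>\<close>, and the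
  bounded error from initial terms is absorbed into \<open>\<delta> * f y\<close> because
  \<open>f\<close> is unbounded.\<close>

lemma f_shift_step:
  assumes "\<forall>\<^sub>F y in sequentially. real (f (y + k)) \<le> \<mu> * real (f y)"
    and "\<epsilon> * real s \<le> real k - 1" "\<mu> \<ge> 0" "\<delta> > 0"
  shows "\<forall>\<^sub>F y in sequentially. real (f (y + s)) \<le> (\<mu> + \<delta>) * real (f y)"
proof -
  obtain Y where Y: "\<And>y. y \<ge> Y \<Longrightarrow> real (f (y + k)) \<le> \<mu> * real (f y)"
    using assms(1) unfolding eventually_sequentially by blast
  have S_bound: "real (S (J + k)) \<le> real (S (Y + k)) + \<mu> * real (S J)" for J
  proof (induction J)
    case 0
    have "S k \<le> S (Y + k)" by (intro S_mono) auto
    moreover have "S 0 = 0" by (simp add: S_def)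
    ultimately show ?case by simp
  next
    case (Suc J)
    show ?case
    proof (cases "Suc J \<le> Y")
      case True
      then have "real (S (Suc J + k)) \<le> real (S (Y + k))" using S_mono[of "Suc J + k" "Y + k"] by simp
      moreover have "0 \<le> \<mu> * real (S (Suc J))" using assms by simp
      ultimately show ?thesis by linarith
    next
      case False
      then have "real (f (Suc J + k)) \<le> \<mu> * real (f (Suc J))" using Y[of "Suc J"] by simp
      then show ?thesis using Suc by (simp add: S_Suc algebra_simps)
    qed
  qed
  obtain K where K: "real (S (Y + k)) / \<delta> \<le> real K" using real_arch_simple by blast
  have "real (f (y + s)) \<le> (\<mu> + \<delta>) * real (f y)" if y: "y \<ge> N" "K \<le> f y" for y
  proof -
    have "\<epsilon> * real (y + s) \<le> \<epsilon> * real y + real k - 1" using assms(2) by (simp add: algebra_simps)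
    moreover have "0 \<le> \<epsilon> * real y" using eps by simp
    ultimately have "nat \<lfloor>\<epsilon> * real (y + s)\<rfloor> \<le> nat \<lfloor>\<epsilon> * real y\<rfloor> + k" by linarith
    then have "f (y + s) \<le> S (nat \<lfloor>\<epsilon> * real y\<rfloor> + k)"
      using f_eq_g[of "y + s"] y S_mono by (simp add: g_def)
    then have "real (f (y + s)) \<le> real (S (Y + k)) + \<mu> * real (f y)"
      using S_bound[of "nat \<lfloor>\<epsilon> * real y\<rfloor>"] f_eq_g[of y] y by (simp add: g_def)
    moreover have "real (S (Y + k)) \<le> \<delta> * real K" using K assms by (simp add: field_simps)
    moreover have "\<delta> * real K \<le> \<delta> * real (f y)" using y assms by simp
    ultimately show ?thesis by (simp add: algebra_simps)
  qed
  then show ?thesis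
    using eventually_conj[OF eventually_ge_at_top[of N] f_unbounded[of K]]
    by (auto elim!: eventually_mono)
qed

text \<open>Passing from \<open>y\<close> to \<open>Suc y\<close> adds at most one summand,
  \<open>f (Suc J)\<close>. Since \<open>\<epsilon> < 1\<close>, for large \<open>y\<close> its
  index is at most \<open>y\<close>, so it is at most \<open>f y\<close>.\<close>

lemma f_Suc_le: "\<forall>\<^sub>F y in sequentially. f (Suc y) \<le> 2 * f y"
proof -
  obtain n0 where n0: "max (1 / (1 - \<epsilon>)) (real (N + 1) / \<epsilon>) \<le> real n0" using real_arch_simple by blast
  have "f (Suc y) \<le> 2 * f y" if y: "y \<ge> max N n0" for y
  proof -
    have ny: "1 / (1 - \<epsilon>) \<le> real y" "real (N + 1) / \<epsilon> \<le> real y" using n0 y by simp_all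
    define J where "J = nat \<lfloor>\<epsilon> * real y\<rfloor>"
    have "1 \<le> (1 - \<epsilon>) * real y" "real (N + 1) \<le> \<epsilon> * real y" using ny eps by (simp_all add: field_simps)
    then have J: "Suc J \<le> y" "N \<le> Suc J" unfolding J_def by (simp_all add: algebra_simps; linarith)+
    have "\<epsilon> * real (Suc y) \<le> \<epsilon> * real y + 1" using eps by (simp add: algebra_simps)
    moreover have "0 \<le> \<epsilon> * real y" using eps by simp
    ultimately have "nat \<lfloor>\<epsilon> * real (Suc y)\<rfloor> \<le> Suc J" unfolding J_def by linarith
    then have "f (Suc y) \<le> S (Suc J)" using f_eq_g[of "Suc y"] y S_mono by (simp add: g_def)
    also have "\<dots> = f y + f (Suc J)" using f_eq_g[of y] y by (simp add: S_Suc g_def J_def)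
    also have "f (Suc J) \<le> f y" using f_mono J by simp
    finally show ?thesis by simp
  qed
  then show ?thesis unfolding eventually_sequentially by blast
qed

lemma f_shift_le_power: "\<forall>\<^sub>F y in sequentially. real (f (y + k)) \<le> 2 ^ k * real (f y)"
proof -
  obtain Y where Y: "\<And>y. y \<ge> Y \<Longrightarrow> f (Suc y) \<le> 2 * f y"
    using f_Suc_le unfolding eventually_sequentially by blast
  have "f (y + k) \<le> 2 ^ k * f y" if "y \<ge> Y" for y
  proof (induction k)
    case (Suc k)
    show ?case using Y[of "y + k"] Suc that by simp
  qed simp
  then have "real (f (y + k)) \<le> 2 ^ k * real (f y)" if "y \<ge> Y" for y
    using that by (metis of_nat_le_iff of_nat_mult of_nat_numeral of_nat_power)
  then show ?thesis unfolding eventually_sequentially by blast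
qed

text \<open>The point is that the constant does not depend on the shift: passing from scale \<open>\<epsilon> y\<close> to
  scale \<open>y\<close> lengthens the admissible shift by almost \<open>1 / \<epsilon>\<close> at the cost of an arbitrarily small
  increase of the constant.\<close>

lemma f_shift_le_uniform:
  "\<exists>M>0. \<forall>k. \<forall>\<^sub>F y in sequentially. real (f (y + k)) \<le> M * real (f y)"
proof -
  \<comment> \<open>With this \<open>k0\<close>, \<open>\<epsilon> * (k + 1) \<le> k - 1\<close> for
    every \<open>k \<ge> k0\<close>, so \<open>f_shift_step\<close> can lengthen the shift by one
    each time.\<close>
  obtain k0 :: nat where k0: "2 / (1 - \<epsilon>) \<le> real k0" using real_arch_simple by blast
  have ev: "\<forall>\<mu> > 2 ^ k0. \<forall>\<^sub>F y in sequentially. real (f (y + (k0 + r))) \<le> \<mu> * real (f y)" for r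
  proof (induction r)
    case 0
    show ?case
    proof (intro allI impI)
      fix \<mu> :: real assume "\<mu> > 2 ^ k0"
      then have "2 ^ k0 * real (f y) \<le> \<mu> * real (f y)" for y by (intro mult_right_mono) auto
      then show "\<forall>\<^sub>F y in sequentially. real (f (y + (k0 + 0))) \<le> \<mu> * real (f y)"
        using f_shift_le_power[of k0] by (auto elim!: eventually_mono intro: order_trans)
    qed
  next
    case (Suc r)
    show ?case
    proof (intro allI impI)
      fix \<mu> :: real assume mu: "\<mu> > 2 ^ k0"
      \<comment> \<open>The shorter shift is bounded with the factor \<open>\<nu>\<close> midway
        between \<open>2 ^ k0\<close> and \<open>\<mu>\<close>, and \<open>\<mu> - \<nu>\<close>
        pays for the step. Quantifying over all \<open>\<mu>\<close> thus keeps the constant from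
        growing with \<open>r\<close>.\<close>
      define \<nu> where "\<nu> = (\<mu> + 2 ^ k0) / 2"
      have nu: "\<nu> > 2 ^ k0" "\<mu> - \<nu> > 0" using mu by (simp_all add: \<nu>_def field_simps)
      have "2 \<le> (1 - \<epsilon>) * real k0" using k0 eps by (simp add: field_simps)
      also have "\<dots> \<le> (1 - \<epsilon>) * real (k0 + r)" using eps by (intro mult_left_mono) auto
      finally have "\<epsilon> * real (k0 + Suc r) \<le> real (k0 + r) - 1" using eps by (simp add: algebra_simps)
      moreover have "\<nu> \<ge> 0" using nu by (meson less_imp_le order_trans zero_le_numeral zero_le_power)
      ultimately show "\<forall>\<^sub>F y in sequentially. real (f (y + (k0 + Suc r))) \<le> \<mu> * real (f y)"
        using f_shift_step[of "k0 + r" \<nu> "k0 + Suc r" "\<mu> - \<nu>"] Suc nu by simp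
    qed
  qed
  have "\<forall>\<^sub>F y in sequentially. real (f (y + k)) \<le> (2 ^ k0 + 1) * real (f y)" for k
  proof -
    have "\<forall>\<^sub>F y in sequentially. real (f (y + (k0 + k))) \<le> (2 ^ k0 + 1) * real (f y)"
      using ev[of k] by simp
    then show ?thesis using eventually_ge_at_top[of N]
    proof eventually_elim
      case (elim y)
      then show ?case using f_mono[of "y + k" "y + (k0 + k)"] by linarith
    qed
  qed
  then show ?thesis by (intro exI[of _ "2 ^ k0 + 1"]) (auto intro: add_pos_pos)
qed

text \<open>Strong induction gives \<open>a n \<le> K * f (n - e)\<close>. The delay satisfies
  \<open>C \<le> (1 - \<epsilon>) * e\<close>, so the \<open>C\<close> extra summands disappear once
  indices are shifted by \<open>e\<close>, and the recurrence at \<open>n - e\<close> closes the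
  induction.\<close>

lemma bigo_if_term_le_sum:
  fixes a :: "nat \<Rightarrow> nat"
  assumes "\<forall>n\<ge>n0. a n \<le> (\<Sum>i<nat \<lceil>\<epsilon> * real n\<rceil> + C. a i)"
  shows "(\<lambda>n. real (a n)) \<in> O(\<lambda>n. real (f (Suc n)))"
proof -
  obtain e :: nat where e: "real C / (1 - \<epsilon>) \<le> real e" using real_arch_simple by blast
  obtain n1 :: nat where n1: "real (C + 1) / (1 - \<epsilon>) \<le> real n1" using real_arch_simple by blast
  \<comment> \<open>The part \<open>e + 2\<close> makes \<open>i - e \<ge> 2\<close> for
    \<open>i \<ge> P\<close>; the term \<open>f 1 \<ge> 1\<close>, left free, then pays for
    \<open>K\<close>, the sum of the first \<open>P\<close> terms.\<close>
  define P where "P = n0 + n1 + N + e + 2"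
  define K where "K = (\<Sum>i<P. a i)"
  have bound: "a n \<le> K * f (n - e)" if "n \<ge> P" for n
    using that
  proof (induction n rule: less_induct)
    case (less n)
    define I where "I = nat \<lceil>\<epsilon> * real n\<rceil> + C"
    have nI: "real I \<le> \<epsilon> * real n + 1 + real C" unfolding I_def using eps by simp
    have "real (C + 1) \<le> (1 - \<epsilon>) * real n1" using n1 eps by (simp add: field_simps)
    also have "\<dots> \<le> (1 - \<epsilon>) * real n" using less eps by (intro mult_left_mono) (auto simp: P_def)
    finally have In: "I \<le> n" using nI by (simp add: algebra_simps)
    have ce: "real C \<le> (1 - \<epsilon>) * real e" using e eps by (simp add: field_simps)
    define J where "J = nat \<lfloor>\<epsilon> * real (n - e)\<rfloor>"
    have "real (I - e) \<le> \<epsilon> * real (n - e) + 1 \<or> I \<le> e"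
      using nI ce less(2) by (auto simp: of_nat_diff P_def algebra_simps)
    then have IJ: "I - e \<le> Suc J" unfolding J_def by linarith
    have SJ: "f (n - e) = S J" using f_eq_g[of "n - e"] less(2) by (simp add: g_def J_def P_def)
    have "S J > 0" using f_pos[of "n - e"] less(2) unfolding SJ by (simp add: P_def)
    then have J1: "J \<ge> 1" by (cases J) (auto simp: S_def)
    have "a n \<le> (\<Sum>i<I. a i)" using assms less(2) by (simp add: P_def I_def)
    also have "\<dots> \<le> (\<Sum>i\<in>{..<P} \<union> {P..<I}. a i)" by (intro sum_mono2) auto
    also have "\<dots> = K + (\<Sum>i\<in>{P..<I}. a i)" unfolding K_def by (intro sum.union_disjoint) auto
    also have "(\<Sum>i\<in>{P..<I}. a i) \<le> (\<Sum>i\<in>{P..<I}. K * f (i - e))"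
      using less In by (intro sum_mono) auto
    also have "\<dots> = K * (\<Sum>i\<in>{P..<I}. f (i - e))" by (simp add: sum_distrib_left)
    also have "(\<Sum>i\<in>{P..<I}. f (i - e)) = (\<Sum>j\<in>(\<lambda>i. i - e) ` {P..<I}. f j)"
      by (subst sum.reindex) (auto simp: inj_on_def P_def)
    also have "\<dots> \<le> (\<Sum>j\<in>{2..J}. f j)"
      using IJ by (intro sum_mono2) (auto simp: P_def)
    also have "K + K * (\<Sum>j\<in>{2..J}. f j) \<le> K * (f 1 + (\<Sum>j\<in>{2..J}. f j))"
      using f_pos[of 1] by (simp add: algebra_simps)
    also have "f 1 + (\<Sum>j\<in>{2..J}. f j) = f (n - e)" using J1 SJ sum.atLeast_Suc_atMost[of 1 J f]
      by (simp add: S_def numeral_2_eq_2)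
    finally show ?case by simp
  qed
  have "a n \<le> K * f (Suc n)" if "n \<ge> P" for n
  proof -
    have "f (n - e) \<le> f (Suc n)" using that by (intro f_mono) (auto simp: P_def)
    then show ?thesis using bound[OF that] by (meson le_trans mult_le_mono2)
  qed
  then have "real (a n) \<le> real K * real (f (Suc n))" if "n \<ge> P" for n
    using that by (metis of_nat_le_iff of_nat_mult)
  then show ?thesis
    by (intro bigoI[of _ "real K"]) (auto simp: eventually_sequentially)
qed

end

section \<open>A slowly growing diagonal function\<close>

lemma slow_function_exists:
  fixes P :: "nat \<Rightarrow> nat \<Rightarrow> bool"
  assumes "\<And>k. \<forall>\<^sub>F n in sequentially. P k n"
  obtains d where "mono d" "\<And>k. \<forall>\<^sub>F n in sequentially. k \<le> d n"
    "\<forall>\<^sub>F n in sequentially. P (d n) n"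
    "\<And>\<delta>::real. \<delta> > 0 \<Longrightarrow> \<forall>\<^sub>F n in sequentially. d n \<le> Suc (d (nat \<lfloor>\<delta> * real n\<rfloor>))"
proof -
  obtain Y where Y: "\<And>k n. n \<ge> Y k \<Longrightarrow> P k n"
    using assms unfolding eventually_sequentially by metis
  \<comment> \<open>\<open>t k\<close> is the threshold where \<open>d\<close> reaches
    \<open>k\<close>. The summand \<open>Y (Suc k)\<close> guarantees \<open>P (Suc k)\<close> from
    the next threshold on, and the factor \<open>Suc k\<close> makes the ratios of consecutive
    thresholds unbounded.\<close>
  define t where "t = rec_nat (0::nat) (\<lambda>k x. Y (Suc k) + Suc k * (x + 1))"
  have t_Suc: "t (Suc k) = Y (Suc k) + Suc k * (t k + 1)" for k by (simp add: t_def)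
  have t_less: "t k < t (Suc k)" for k unfolding t_Suc by simp
  then have t_mono: "strict_mono t" by (simp add: strict_mono_Suc_iff)
  define d where "d n = card {k. t (Suc k) \<le> n}" for n
  have fin: "finite {k. t (Suc k) \<le> n}" for n
  proof (rule finite_subset)
    show "{k. t (Suc k) \<le> n} \<subseteq> {..n}"
      using strict_mono_imp_increasing[OF t_mono] by (auto dest!: Suc_leD intro: le_trans)
  qed simp
  have "{k. t (Suc k) \<le> n} = {..<d n}" for n
    unfolding d_def using fin
  proof (rule downward_closed_eq_lessThan_card)
    fix i j assume "i \<in> {k. t (Suc k) \<le> n}" "j \<le> i"
    then show "j \<in> {k. t (Suc k) \<le> n}"
      using strict_mono_less_eq[OF t_mono, of "Suc j" "Suc i"] by simp
  qed
  then have d_iff: "k < d n \<longleftrightarrow> t (Suc k) \<le> n" for k n by blast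
  have d_ge: "k \<le> d n" if "t k \<le> n" for k n
    using that d_iff[of "k - 1" n] by (cases k) auto
  show ?thesis
  proof
    show "mono d" unfolding d_def mono_def using fin by (auto intro!: card_mono)
    show large: "\<forall>\<^sub>F n in sequentially. k \<le> d n" for k
      using d_ge unfolding eventually_sequentially by blast
    show "\<forall>\<^sub>F n in sequentially. P (d n) n"
      using large[of 1]
    proof eventually_elim
      case (elim n)
      then obtain k where k: "d n = Suc k" by (cases "d n") auto
      then have "t (Suc k) \<le> n" using d_iff[of k n] by simp
      then show ?case using Y[of "Suc k" n] k by (simp add: t_Suc)
    qed
    fix \<delta> :: real assume \<delta>: "\<delta> > 0"
    obtain K where K: "1 / \<delta> \<le> real K" using real_arch_simple by blast
    \<comment> \<open>Such an \<open>n\<close> is at least \<open>d n\<close> times the previous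
      threshold. Once \<open>d n\<close> exceeds \<open>1 / \<delta>\<close>, multiplying
      \<open>n\<close> by \<open>\<delta>\<close> stays above that threshold, so \<open>d\<close>
      drops by at most one.\<close>
    show "\<forall>\<^sub>F n in sequentially. d n \<le> Suc (d (nat \<lfloor>\<delta> * real n\<rfloor>))"
      using large[of "K + 2"]
    proof eventually_elim
      case (elim n)
      define k where "k = d n - 2"
      have k: "d n = Suc (Suc k)" using elim by (simp add: k_def)
      have "Suc (Suc k) * (t (Suc k) + 1) \<le> t (Suc (Suc k))" unfolding t_Suc[of "Suc k"] by simp
      also have "\<dots> \<le> n" using d_iff[of "Suc k" n] k by simp
      finally have n: "real (Suc (Suc k)) * real (t (Suc k) + 1) \<le> real n"
        by (metis of_nat_le_iff of_nat_mult)
      have "1 \<le> \<delta> * real K" using K \<delta> by (simp add: field_simps)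
      also have "\<dots> \<le> \<delta> * real (Suc (Suc k))" using elim k \<delta> by simp
      finally have "1 * real (t (Suc k) + 1) \<le> \<delta> * real (Suc (Suc k)) * real (t (Suc k) + 1)"
        by (intro mult_right_mono) auto
      also have "\<dots> \<le> \<delta> * real n" using n \<delta> by (simp only: mult.assoc mult_left_mono less_imp_le)
      finally have "t (Suc k) \<le> nat \<lfloor>\<delta> * real n\<rfloor>" by (simp add: le_nat_floor)
      then show ?case using d_iff[of k "nat \<lfloor>\<delta> * real n\<rfloor>"] k by linarith
    qed
  qed
qed

section \<open>Completeness of dense subsequences of a block sequence\<close>

lemma infinite_close_pairs:
  fixes B :: "nat set" and \<epsilon> :: real
  assumes w: "\<epsilon> * real w > 1"
    and dens: "\<And>m. m \<ge> m0 \<Longrightarrow> real (card (B \<inter> {..<m})) \<ge> \<epsilon> * real m"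
  shows "\<exists>j\<in>{1..<w}. infinite {i\<in>B. i + j \<in> B \<and> i div w = (i + j) div w}"
proof (rule ccontr)
  assume "\<not> ?thesis"
  then have "finite (\<Union>j\<in>{1..<w}. {i\<in>B. i + j \<in> B \<and> i div w = (i + j) div w})" by auto
  then obtain b where "(\<Union>j\<in>{1..<w}. {i\<in>B. i + j \<in> B \<and> i div w = (i + j) div w}) \<subseteq> {..<b}"
    using finite_nat_bounded by blast
  then have b: "i < b" if "i \<in> B" "i + j \<in> B" "i div w = (i + j) div w" "1 \<le> j" "j < w" for i j
    using that by force
  have w0: "w > 0" using w by (cases w) auto
  \<comment> \<open>Two elements of \<open>B\<close> beyond \<open>b\<close> in one block would
    differ by less than \<open>w\<close>. So each block holds at most one, and the density of
    \<open>B\<close> is asymptotically at most \<open>1 / w < \<epsilon>\<close>.\<close>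
  have sep: "\<not> (i \<in> B \<and> i' \<in> B \<and> b \<le> i \<and> i < i' \<and> i div w = i' div w)" for i i'
  proof
    assume *: "i \<in> B \<and> i' \<in> B \<and> b \<le> i \<and> i < i' \<and> i div w = i' div w"
    have "i' < w + w * (i' div w)" "w * (i div w) \<le> i"
      using w0 by (rule dividend_less_times_div) simp
    then have "i' < w + i" using * by (metis add_left_mono order_less_le_trans)
    then have "i' - i < w" using * by linarith
    moreover have "1 \<le> i' - i" using * by linarith
    ultimately show False using b[of i "i' - i"] * by simp
  qed
  have inj: "inj_on (\<lambda>i. i div w) (B \<inter> {b..})"
  proof (rule inj_onI)
    fix i i' assume "i \<in> B \<inter> {b..}" "i' \<in> B \<inter> {b..}" "i div w = i' div w"
    then show "i = i'" using sep[of i i'] sep[of i' i] by (cases i i' rule: linorder_cases) auto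
  qed
  have upper: "real (card (B \<inter> {..<m})) \<le> real b + real m / real w + 1" for m
  proof -
    have "card (B \<inter> {..<m}) \<le> card ({..<b} \<union> (B \<inter> {b..} \<inter> {..<m}))" by (intro card_mono) auto
    also have "\<dots> \<le> b + card (B \<inter> {b..} \<inter> {..<m})" using card_Un_le[of "{..<b}"] by simp
    also have "card (B \<inter> {b..} \<inter> {..<m}) = card ((\<lambda>i. i div w) ` (B \<inter> {b..} \<inter> {..<m}))"
      using inj by (intro card_image[symmetric]) (auto simp: inj_on_def)
    also have "\<dots> \<le> card {..m div w}" by (intro card_mono) (auto intro: div_le_mono)
    finally have "real (card (B \<inter> {..<m})) \<le> real b + real (m div w) + 1" by simp
    moreover have "real (m div w) \<le> real m / real w" by (simp add: of_nat_div_le_of_nat)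
    ultimately show ?thesis by linarith
  qed
  define \<eta> where "\<eta> = \<epsilon> - 1 / real w"
  have \<eta>: "\<eta> > 0" using w w0 by (simp add: \<eta>_def field_simps)
  obtain m1 where m1: "(real b + 2) / \<eta> \<le> real m1" using real_arch_simple by blast
  define m where "m = max m0 m1"
  have "real b + 2 \<le> \<eta> * real m1" using m1 \<eta> by (simp add: field_simps)
  also have "\<dots> \<le> \<eta> * real m" using \<eta> by (intro mult_left_mono) (auto simp: m_def)
  finally have "real b + 2 \<le> \<epsilon> * real m - real m / real w" by (simp add: \<eta>_def algebra_simps)
  then show False using dens[of m] upper[of m] by (simp add: m_def)
qed

text \<open>Pairs of terms of a dense subsequence lying in a common block have a fixed difference \<open>d\<close>
  infinitely often; \<open>K\<close> such pairs together with \<open>d\<close> terms of one residue class coprime to \<open>d\<close>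
  represent an interval of length about \<open>K d\<close>. Taking the pairs sparse enough keeps the growth
  condition for the remaining terms.\<close>

lemma eps_complete_block_sequence:
  fixes a :: "nat \<Rightarrow> nat" and \<epsilon> :: real
  assumes eps: "\<epsilon> > 0"
    and a: "strict_mono a" "\<And>i. a i \<ge> 1"
    and w: "\<epsilon> * real w > 1" and D: "D > 0"
    and block: "\<And>i j. i div w = (i + j) div w \<Longrightarrow> a (i + j) = a i + D * j"
    and coprime: "\<And>i j. 1 \<le> j \<Longrightarrow> j < w \<Longrightarrow> coprime (a i) (D * j)"
    and tight: "\<And>c::nat. \<forall>\<^sub>F m in sequentially.
      \<forall>I. \<epsilon> * real m - real c \<le> real I \<longrightarrow> a m \<le> (\<Sum>i<I. a i)"
  shows "eps_complete \<epsilon> (range a)"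
  unfolding eps_complete_def
proof (intro allI impI)
  fix A' assume A': "A' \<subseteq> range a"
    and "\<exists>N. \<forall>n\<ge>N. \<epsilon> * real (card (range a \<inter> {1..n})) \<le> real (card (A' \<inter> {1..n}))"
  then obtain n0 where n0: "\<And>n. n \<ge> n0 \<Longrightarrow> \<epsilon> * real (card (range a \<inter> {1..n})) \<le> real (card (A' \<inter> {1..n}))"
    by blast
  define B where "B = {i. a i \<in> A'}"
  have AB: "A' = a ` B" using A' by (auto simp: B_def)
  have dens: "\<epsilon> * real m \<le> real (card (B \<inter> {..<m}))" if m: "m \<ge> Suc n0" for m
  proof -
    obtain m' where m': "m = Suc m'" "n0 \<le> m'" using m by (cases m) auto
    have "n0 \<le> a m'" using strict_mono_imp_increasing[OF a(1), of m'] m' by simp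
    from n0[OF this] have "\<epsilon> * real (card {..m'}) \<le> real (card (B \<inter> {..m'}))"
      using image_atMost_strict_mono[OF a, of UNIV m'] image_atMost_strict_mono[OF a, of B m']
      by (simp add: AB card_image_strict_mono[OF a(1)])
    then show ?thesis using m' by (simp add: lessThan_Suc_atMost)
  qed
  obtain j where j: "1 \<le> j" "j < w" and inf_pairs: "infinite {i\<in>B. i + j \<in> B \<and> i div w = (i + j) div w}"
    using infinite_close_pairs[OF w, of "Suc n0" B] dens by auto
  define PJ where "PJ = {i\<in>B. i + j \<in> B \<and> i div w = (i + j) div w}"
  have infPJ: "infinite PJ" using inf_pairs by (simp add: PJ_def)
  then have infB: "infinite B" using finite_subset[of PJ B] by (auto simp: PJ_def)
  define d where "d = D * j"
  have d: "d > 0" using D j by (simp add: d_def)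
  have "finite ((\<lambda>i. a i mod d) ` B)" by (rule finite_subset[of _ "{..<d}"]) (use d in auto)
  then obtain i0 where i0: "i0 \<in> B" "infinite {i\<in>B. a i mod d = a i0 mod d}"
    using pigeonhole_infinite[OF infB] by blast
  then obtain RI where RI: "RI \<subseteq> {i\<in>B. a i mod d = a i0 mod d}" "finite RI" "card RI = d"
    using infinite_arbitrarily_large by blast
  define R where "R = a ` RI"
  have R: "finite R" "card R = d" "\<And>x. x \<in> R \<Longrightarrow> [x = a i0] (mod d)" "coprime (a i0) d"
    using RI coprime[OF j] by (auto simp: R_def card_image_strict_mono[OF a(1)] cong_def d_def)
  \<comment> \<open>\<open>T k\<close> is a point beyond which the growth condition survives the
    loss of \<open>d\<close> residue terms and both members of \<open>k\<close> pairs.\<close>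
  have "\<forall>k. \<exists>T. \<forall>m\<ge>T. \<forall>I. \<epsilon> * real m - real (d + 2 * k) \<le> real I \<longrightarrow> a m \<le> (\<Sum>i<I. a i)"
    using tight unfolding eventually_sequentially by blast
  then obtain T where T: "\<And>k m I. m \<ge> T k \<Longrightarrow> \<epsilon> * real m - real (d + 2 * k) \<le> real I \<Longrightarrow> a m \<le> (\<Sum>i<I. a i)"
    by metis
  obtain \<rho> where \<rho>: "RI \<subseteq> {..<\<rho>}" using finite_nat_bounded[OF RI(2)] by blast
  \<comment> \<open>The pair at \<open>x k\<close> lies beyond \<open>T (Suc k)\<close>, so the loss
    of \<open>Suc k\<close> pairs is tolerated from there on. The bound \<open>\<rho>\<close>
    separates the pairs from \<open>RI\<close>, and gaps above \<open>w > j\<close> keep them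
    disjoint from each other.\<close>
  have "\<exists>x. \<forall>k. (x k \<in> PJ \<and> T (Suc k) \<le> x k \<and> \<rho> \<le> x k) \<and> x k + w < x (Suc k)"
  proof (rule dependent_nat_choice)
    show "\<exists>x. x \<in> PJ \<and> T (Suc 0) \<le> x \<and> \<rho> \<le> x"
      using infPJ unfolding infinite_nat_iff_unbounded_le
      by (meson le_trans max.cobounded1 max.cobounded2)
    show "\<exists>y. (y \<in> PJ \<and> T (Suc (Suc n)) \<le> y \<and> \<rho> \<le> y) \<and> x + w < y" for x n
    proof -
      obtain y where "y \<in> PJ" "T (Suc (Suc n)) + \<rho> + x + w < y"
        using infPJ unfolding infinite_nat_iff_unbounded by blast
      then show ?thesis by (intro exI[of _ y]) auto
    qed
  qed
  then obtain x where x: "\<And>k. x k \<in> PJ" "\<And>k. T (Suc k) \<le> x k" "\<And>k. \<rho> \<le> x k"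
    "\<And>k. x k + w < x (Suc k)" by blast
  have x_mono: "strict_mono x" unfolding strict_mono_Suc_iff using x(4) by (meson add_lessD1)
  have x_gap: "x k + w < x l" if "k < l" for k l
    using x(4)[of k] strict_mono_less_eq[OF x_mono, of "Suc k" l] that by simp
  define N1 where "N1 = max (Suc n0) (T 0)"
  \<comment> \<open>Each pair lengthens the interval by \<open>d \<ge> 1\<close>, so
    \<open>K\<close> pairs leave a length of at least \<open>a N1\<close> after subtracting
    \<open>\<Sum>R\<close>. This handles the remaining terms up to index \<open>N1\<close>; the
    growth condition handles those beyond.\<close>
  define K where "K = a N1 + \<Sum>R"
  define XI where "XI = x ` {..<K}"
  define XJ where "XJ = (\<lambda>i. i + j) ` XI"
  define HI where "HI = B - (RI \<union> XI \<union> XJ)"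
  define X where "X = a ` XI"
  have shift: "(\<lambda>y. y + d) ` X = a ` XJ"
  proof -
    have "a (x k + j) = a (x k) + d" for k using x(1)[of k] block[of "x k" j] by (simp add: PJ_def d_def)
    then show ?thesis by (auto simp: X_def XI_def XJ_def image_image)
  qed
  have inj: "inj a" using a(1) by (rule strict_mono_imp_inj_on)
  have XIJ: "XI \<inter> XJ = {}"
  proof -
    have "x k \<noteq> x l + j" for k l
    proof (cases "l < k")
      case True
      then show ?thesis using x_gap[of l k] j by simp
    next
      case False
      then show ?thesis using strict_mono_less_eq[OF x_mono, of k l] j by simp
    qed
    then show ?thesis by (auto simp: XI_def XJ_def)
  qed
  have XR: "(XI \<union> XJ) \<inter> RI = {}"
  proof -
    have "x k \<notin> RI" "x k + j \<notin> RI" for k using x(3)[of k] \<rho> by auto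
    then show ?thesis by (auto simp: XI_def XJ_def)
  qed
  have card_X: "card X = K"
    unfolding X_def XI_def card_image_strict_mono[OF a(1)] card_image_strict_mono[OF x_mono] by simp
  have finX: "finite X" by (simp add: X_def XI_def)
  define V where "V = X \<union> (\<lambda>y. y + d) ` X \<union> R"
  have V: "V = a ` (XI \<union> XJ \<union> RI)" unfolding V_def shift by (simp add: X_def R_def image_Un)
  have "{\<Sum>X + \<Sum>R..\<Sum>X + card X * d} \<subseteq> subset_sums V"
    unfolding V_def
  proof (rule interval_in_subset_sums_of_pairs[OF d R])
    show "X \<inter> (\<lambda>y. y + d) ` X = {}" unfolding shift unfolding X_def
      using XIJ inj by (simp flip: image_Int)
    show "(X \<union> (\<lambda>y. y + d) ` X) \<inter> R = {}" unfolding shift unfolding X_def R_def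
      using XR inj by (simp flip: image_Int image_Un)
  qed (use finX in auto)
  moreover have "a N1 + \<Sum>R \<le> K * d" using d by (simp add: K_def)
  ultimately have interval: "{\<Sum>X + \<Sum>R..\<Sum>X + \<Sum>R + (K * d - \<Sum>R)} \<subseteq> subset_sums V"
    and Z: "a N1 \<le> K * d - \<Sum>R" by (simp_all add: card_X)
  have "complete_seq (V \<union> a ` HI)"
  proof (rule complete_seq_extend_interval[OF interval])
    show "V \<inter> a ` HI = {}" unfolding V using inj by (auto simp: HI_def inj_eq)
    have "finite (RI \<union> XI \<union> XJ)" using RI by (simp add: XI_def XJ_def)
    then have "infinite HI" using infB by (simp add: HI_def Diff_infinite_finite)
    then show "infinite (a ` HI)" using inj by (simp add: finite_image_iff inj_on_subset)
    fix h assume "h \<in> a ` HI"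
    then obtain m where m: "m \<in> HI" "h = a m" by blast
    have sum_eq: "\<Sum>{h' \<in> a ` HI. h' < h} = (\<Sum>i\<in>HI \<inter> {..<m}. a i)"
      unfolding m image_lessThan_strict_mono[OF a(1)]
      using inj by (subst sum.reindex) (auto intro: inj_on_subset)
    show "h \<le> K * d - \<Sum>R + \<Sum>{h' \<in> a ` HI. h' < h}"
    proof (cases "m \<le> N1")
      case True
      then have "a m \<le> a N1" using a(1) by (simp add: strict_mono_less_eq)
      then show ?thesis using Z m by simp
    next
      case False
      \<comment> \<open>Only pairs starting below \<open>m\<close> remove indices below
        \<open>m\<close>, and the last of them starts at or beyond \<open>T \<kappa>\<close>. The
        loss is thus at most \<open>d + 2 * \<kappa>\<close>, independently of the total number
        \<open>K\<close> of pairs, which is why \<open>K\<close> may depend on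
        \<open>N1\<close>.\<close>
      define \<kappa> where "\<kappa> = card {k. k < K \<and> x k < m}"
      have \<kappa>: "{k. k < K \<and> x k < m} = {..<\<kappa>}"
        unfolding \<kappa>_def
      proof (rule downward_closed_eq_lessThan_card)
        fix i i' assume "i \<in> {k. k < K \<and> x k < m}" "i' \<le> i"
        then show "i' \<in> {k. k < K \<and> x k < m}"
          using strict_mono_less_eq[OF x_mono, of i' i] by auto
      qed simp
      have "T \<kappa> \<le> m"
      proof (cases \<kappa>)
        case 0
        then show ?thesis using False by (simp add: N1_def)
      next
        case (Suc k)
        then have "x k < m" using \<kappa> by auto
        then show ?thesis using x(2)[of k] Suc by simp
      qed
      define I where "I = card (HI \<inter> {..<m})"
      have "B \<inter> {..<m} \<subseteq> (HI \<inter> {..<m}) \<union> (RI \<union> (x ` {..<\<kappa>} \<union> (\<lambda>k. x k + j) ` {..<\<kappa>}))"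
        using \<kappa> by (auto simp: HI_def XI_def XJ_def)
      then have "card (B \<inter> {..<m}) \<le> card ((HI \<inter> {..<m}) \<union> (RI \<union> (x ` {..<\<kappa>} \<union> (\<lambda>k. x k + j) ` {..<\<kappa>})))"
        using RI by (intro card_mono) auto
      also have "\<dots> \<le> I + (d + (\<kappa> + \<kappa>))"
        unfolding I_def RI(3)[symmetric]
        by (intro order_trans[OF card_Un_le] add_mono order_refl order_trans[OF card_image_le]) auto
      finally have "real (card (B \<inter> {..<m})) \<le> real I + real (d + 2 * \<kappa>)" by simp
      moreover have "\<epsilon> * real m \<le> real (card (B \<inter> {..<m}))" using False by (intro dens) (simp add: N1_def)
      ultimately have "a m \<le> (\<Sum>i<I. a i)" using T[OF \<open>T \<kappa> \<le> m\<close>, of I] by linarith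
      also have "\<dots> \<le> (\<Sum>i\<in>HI \<inter> {..<m}. a i)"
        unfolding I_def using a(1) by (intro sum_lessThan_card_le strict_mono_mono) auto
      finally show ?thesis unfolding sum_eq using m(2) by simp
    qed
  qed
  moreover have "V \<union> a ` HI = A'"
  proof -
    have "XI \<union> XJ \<union> RI \<subseteq> B" using x(1) RI by (auto simp: XI_def XJ_def PJ_def)
    then show ?thesis unfolding V AB HI_def by auto
  qed
  ultimately show "complete_seq A'" by simp
qed

section \<open>The explicit sequence and its growth\<close>

locale block_construction = fractional_sum_sequence +
  fixes M :: real and d :: "nat \<Rightarrow> nat" and w :: nat
  assumes M: "M > 0" and f_shift: "\<forall>\<^sub>F n in sequentially. real (f (n + d n)) \<le> M * real (f n)"
    and d_mono: "mono d" and d_large: "\<And>k. \<forall>\<^sub>F n in sequentially. k \<le> d n"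
    and d_square: "\<forall>\<^sub>F n in sequentially. d n * d n \<le> n"
    and d_slow: "\<And>\<delta>::real. \<delta> > 0 \<Longrightarrow> \<forall>\<^sub>F n in sequentially. d n \<le> Suc (d (nat \<lfloor>\<delta> * real n\<rfloor>))"
    and w: "\<epsilon> * real w > 1"
begin

definition \<beta> :: "nat \<Rightarrow> nat" where "\<beta> i = w * (i div w)"

definition \<phi> :: "nat \<Rightarrow> nat" where "\<phi> i = \<beta> i + d (\<beta> i)"

text \<open>The shift by the slowly growing \<open>d\<close> gives room in the growth condition, constancy of \<open>\<phi>\<close>
  on blocks of length \<open>w\<close> gives bounded gaps, and the factor \<open>w!\<close> makes all terms coprime to these gaps.\<close>

definition a :: "nat \<Rightarrow> nat" where "a i = 1 + fact w * (g (\<phi> i) + i)"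

lemma w_pos: "w > 0"
  using w by (cases w) auto

lemma \<beta>_bounds: "\<beta> i \<le> i" "i < \<beta> i + w"
  using dividend_less_times_div[OF w_pos, of i] by (simp_all add: \<beta>_def)

lemma \<phi>_mono: "i \<le> j \<Longrightarrow> \<phi> i \<le> \<phi> j"
  unfolding \<phi>_def \<beta>_def using d_mono by (intro add_mono monoD[OF d_mono] mult_le_mono2 div_le_mono)

lemma a_strict_mono: "strict_mono a"
proof (rule strict_monoI)
  fix i j :: nat assume "i < j"
  then have "g (\<phi> i) + i < g (\<phi> j) + j" using g_mono[OF \<phi>_mono, of i j] by simp
  then show "a i < a j" by (simp add: a_def)
qed

lemma a_pos: "a i \<ge> 1"
  by (simp add: a_def)

lemma a_block: "i div w = (i + j) div w \<Longrightarrow> a (i + j) = a i + fact w * j"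
  by (simp add: a_def \<phi>_def \<beta>_def algebra_simps)

lemma a_coprime:
  assumes "1 \<le> j" "j < w"
  shows "coprime (a i) (fact w * j)"
proof -
  have *: "coprime (a i) (fact w)" unfolding a_def
    by (metis add.commute coprime_1_left coprime_commute coprime_iff_gcd_eq_1 gcd_add_mult mult.commute)
  moreover have "j dvd fact w" using assms by (intro dvd_fact) auto
  ultimately show ?thesis using coprime_divisors[of "a i" "a i" j "fact w"] by simp
qed

text \<open>Rounding down to a block start loses less than \<open>w\<close>, which \<open>d\<close>
  outweighs, so \<open>\<phi> n \<ge> Suc n\<close> for large \<open>n\<close>. Conversely
  \<open>\<phi> n \<le> n + d n\<close>, where \<open>f_shift\<close> costs only the factor
  \<open>M\<close>; superlinear growth of \<open>f\<close> absorbs the linear term.\<close>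

lemma a_bigtheta: "(\<lambda>n. real (a n)) \<in> \<Theta>(\<lambda>n. real (f (Suc n)))"
proof -
  obtain n1 where n1: "\<And>n. n \<ge> n1 \<Longrightarrow> w \<le> d n"
    using d_large[of w] unfolding eventually_sequentially by blast
  define C where "C = 1 + fact w * (M + 1)"
  have Suc: "\<forall>\<^sub>F n in sequentially. real (Suc n) \<le> real (f (Suc n))"
    using f_superlinear[of 1] unfolding eventually_sequentially by (metis le_SucI mult_1)
  have "\<forall>\<^sub>F n in sequentially. 1 * norm (real (f (Suc n))) \<le> norm (real (a n)) \<and>
      norm (real (a n)) \<le> C * norm (real (f (Suc n)))"
    using eventually_ge_at_top[of "N + n1 + w"] f_shift Suc
  proof eventually_elim
    case (elim n)
    have "n1 \<le> \<beta> n" using \<beta>_bounds(2)[of n] elim(1) by simp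
    then have "Suc n \<le> \<phi> n" using n1[of "\<beta> n"] \<beta>_bounds(2)[of n] by (simp add: \<phi>_def)
    then have "f (Suc n) \<le> g (\<phi> n)" using g_mono f_eq_g[of "Suc n"] elim(1) by simp
    also have "\<dots> \<le> a n" using mult_le_mono1[OF fact_ge_1, of "g (\<phi> n) + n" w]
      unfolding a_def by (metis add_leD1 mult_1 trans_le_add2)
    finally have lower: "f (Suc n) \<le> a n" .
    have "\<phi> n \<le> n + d n" unfolding \<phi>_def using \<beta>_bounds(1) by (intro add_mono monoD[OF d_mono]) auto
    then have "g (\<phi> n) \<le> f (n + d n)" using g_mono f_eq_g[of "n + d n"] elim(1) by simp
    moreover have "M * real (f n) \<le> M * real (f (Suc n))"
      using f_mono[of n "Suc n"] elim(1) M by simp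
    ultimately have "real (g (\<phi> n) + n) \<le> (M + 1) * real (f (Suc n))"
      using elim(2,3) by (simp add: algebra_simps)
    then have "fact w * real (g (\<phi> n) + n) \<le> fact w * ((M + 1) * real (f (Suc n)))"
      by (intro mult_left_mono) auto
    moreover have "real (a n) = 1 + fact w * real (g (\<phi> n) + n)" by (simp add: a_def)
    moreover have "1 \<le> real (f (Suc n))" using elim(3) by simp
    ultimately have "real (a n) \<le> C * real (f (Suc n))" by (simp add: C_def algebra_simps)
    then show ?case using lower by simp
  qed
  moreover have "C > 0" using M by (simp add: C_def add_pos_pos)
  ultimately show ?thesis by (intro bigthetaI'[of 1 C]) auto
qed

text \<open>Up to constants, \<open>g (\<phi> m)\<close> sums \<open>f\<close> as far as
  \<open>\<epsilon> * (m + d m)\<close>, while the shifted terms on the right reach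
  \<open>\<epsilon> * m + d m\<close>. The surplus \<open>(1 - \<epsilon>) * d m\<close> yields two
  further terms: \<open>f (J + 1)\<close> pays for the linear term \<open>m\<close>, and
  \<open>f (J + 2)\<close> for the small indices left out of the comparison.\<close>

lemma a_le_sum:
  "\<forall>\<^sub>F m in sequentially. \<forall>I. \<epsilon> * real m - real (c::nat) \<le> real I \<longrightarrow> a m \<le> (\<Sum>i<I. a i)"
proof -
  \<comment> \<open>This makes the left-out range, which ends at
    \<open>I0 + E \<le> 2 * \<delta> * m\<close>, lie below \<open>\<epsilon> * (J + 2)\<close>, so
    its whole sum is at most \<open>f (J + 2)\<close>.\<close>
  define \<delta> where "\<delta> = \<epsilon>\<^sup>2 / 3"
  have \<delta>: "\<delta> > 0" using eps by (simp add: \<delta>_def)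
  obtain n1 where n1: "\<And>n. n \<ge> n1 \<Longrightarrow> 1 / \<epsilon> * real n \<le> real (f n)"
    using f_superlinear[of "1 / \<epsilon>"] unfolding eventually_sequentially by blast
  obtain K1 :: nat where K1: "max (1 / \<delta>) (real (c + w + 3) / (1 - \<epsilon>)) \<le> real K1"
    using real_arch_simple by blast
  obtain m1 :: nat where m1: "real (n1 + N + c + 1) / \<epsilon> \<le> real m1" using real_arch_simple by blast
  show ?thesis
    using d_slow[OF \<delta>] d_square d_large[of "K1 + w + N"] eventually_ge_at_top[of m1]
  proof eventually_elim
    case (elim m)
    show ?case
    proof (intro allI impI)
      fix I :: nat assume I: "\<epsilon> * real m - real c \<le> real I"
      define I0 where "I0 = nat \<lfloor>\<delta> * real m\<rfloor> + w"
      \<comment> \<open>For \<open>i \<ge> I0\<close> the block start is at least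
        \<open>nat \<lfloor>\<delta> * real m\<rfloor>\<close>, so \<open>d_slow\<close> gives a
        shift of at least \<open>d m - 1\<close> there; rounding loses at most \<open>w - 1\<close>.
        What remains is at least \<open>E\<close>.\<close>
      define E where "E = d m - w"
      define J where "J = nat \<lfloor>\<epsilon> * real (\<phi> m)\<rfloor>"
      have E: "d m = E + w" "N \<le> E" using elim(3) by (simp_all add: E_def)
      have \<phi>_ge: "i + E \<le> \<phi> i" if "I0 \<le> i" for i
      proof -
        have "nat \<lfloor>\<delta> * real m\<rfloor> \<le> \<beta> i" using \<beta>_bounds(2)[of i] that by (simp add: I0_def)
        then have "d m \<le> Suc (d (\<beta> i))" using elim(1) monoD[OF d_mono] by (meson Suc_le_mono le_trans)
        then show ?thesis using \<beta>_bounds(2)[of i] E by (simp add: \<phi>_def)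
      qed
      have d_le: "real (d m) \<le> \<delta> * real m"
      proof -
        have "1 / \<delta> \<le> real (d m)" using K1 elim(3) by simp
        then have "1 \<le> \<delta> * real (d m)" using \<delta> by (simp add: field_simps)
        then have "1 * real (d m) \<le> \<delta> * real (d m) * real (d m)" by (intro mult_right_mono) auto
        also have "\<dots> = \<delta> * real (d m * d m)" by simp
        also have "\<dots> \<le> \<delta> * real m" using elim(2) \<delta> by (intro mult_left_mono) (simp_all only: of_nat_le_iff less_imp_le)
        finally show ?thesis by simp
      qed
      have I0_le: "real I0 + real E \<le> 2 * (\<delta> * real m)"
      proof -
        have "real (nat \<lfloor>\<delta> * real m\<rfloor>) \<le> \<delta> * real m" using \<delta> by simp
        then show ?thesis using d_le E(1) unfolding I0_def by linarith
      qed
      have \<delta>2: "2 * (\<delta> * real m) \<le> \<epsilon> * (\<epsilon> * real m)"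
        using eps by (simp add: \<delta>_def power2_eq_square field_simps)
      have "\<epsilon> * (\<epsilon> * real m) \<le> 1 * (1 * real m)" using eps by (intro mult_mono) auto
      then have "I0 \<le> m" using I0_le \<delta>2 by linarith
      then have \<phi>m: "m \<le> \<phi> m" using \<phi>_ge[of m] by simp
      have J_ge: "\<epsilon> * real m \<le> real (J + 1)"
      proof -
        have "\<epsilon> * real m \<le> \<epsilon> * real (\<phi> m)" using \<phi>m eps by (intro mult_left_mono) auto
        then show ?thesis unfolding J_def by linarith
      qed
      have m_ge: "real (n1 + N + c + 1) \<le> \<epsilon> * real m"
      proof -
        have "real (n1 + N + c + 1) \<le> \<epsilon> * real m1" using m1 eps by (simp add: field_simps)
        also have "\<dots> \<le> \<epsilon> * real m" using elim(4) eps by (intro mult_left_mono) auto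
        finally show ?thesis .
      qed
      have JI: "J + 3 \<le> I + E"
      proof -
        have "\<phi> m \<le> m + d m" unfolding \<phi>_def using \<beta>_bounds(1)[of m] by (intro add_mono monoD[OF d_mono]) auto
        then have "\<epsilon> * real (\<phi> m) \<le> \<epsilon> * real (m + d m)" using eps by (intro mult_left_mono) auto
        moreover have "real J \<le> \<epsilon> * real (\<phi> m)" unfolding J_def using eps by simp
        ultimately have "real J \<le> \<epsilon> * real m + \<epsilon> * real (d m)" by (simp add: algebra_simps)
        moreover have "real (c + w + 3) / (1 - \<epsilon>) \<le> real (d m)" using K1 elim(3) by simp
        then have "real (c + w + 3) \<le> (1 - \<epsilon>) * real (d m)" using eps by (simp add: field_simps)
        ultimately show ?thesis using I E by (simp add: algebra_simps)
      qed
      have f1: "m \<le> f (J + 1)"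
      proof -
        have "1 / \<epsilon> * real (J + 1) \<le> real (f (J + 1))" using J_ge m_ge by (intro n1) linarith
        moreover have "real m \<le> 1 / \<epsilon> * real (J + 1)" using J_ge eps by (simp add: field_simps)
        ultimately show ?thesis by linarith
      qed
      have f2: "S (I0 + E) \<le> f (J + 2)"
      proof -
        have "\<epsilon> * (\<epsilon> * real m) \<le> \<epsilon> * real (J + 2)" using J_ge eps by (intro mult_left_mono) auto
        then have "real (I0 + E) \<le> \<epsilon> * real (J + 2)" using I0_le \<delta>2 by simp
        then have "I0 + E \<le> nat \<lfloor>\<epsilon> * real (J + 2)\<rfloor>" by (simp add: le_nat_floor)
        moreover have "N \<le> J + 2" using J_ge m_ge by linarith
        ultimately show ?thesis using f_eq_g[of "J + 2"] S_mono by (simp add: g_def)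
      qed
      have "S (J + 2) \<le> (\<Sum>i\<in>{1..I0 + E} \<union> {I0 + E..<I + E}. f i)"
        unfolding S_def using JI by (intro sum_mono2) auto
      also have "\<dots> \<le> S (I0 + E) + (\<Sum>i\<in>{I0 + E..<I + E}. f i)"
        unfolding S_def by (subst sum_Un_nat) auto
      also have "(\<Sum>i\<in>{I0 + E..<I + E}. f i) = (\<Sum>i\<in>{I0..<I}. f (i + E))"
        by (rule sum.shift_bounds_nat_ivl)
      also have "\<dots> \<le> (\<Sum>i\<in>{I0..<I}. g (\<phi> i))"
        using \<phi>_ge g_mono f_eq_g E by (intro sum_mono) simp
      also have "\<dots> \<le> (\<Sum>i<I. g (\<phi> i))" by (intro sum_mono2) auto
      finally have "S J + m \<le> (\<Sum>i<I. g (\<phi> i))"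
        using f1 f2 by (simp add: S_Suc numeral_2_eq_2)
      then have "g (\<phi> m) + m \<le> (\<Sum>i<I. g (\<phi> i))" by (simp add: g_def J_def)
      then have "a m \<le> 1 + fact w * (\<Sum>i<I. g (\<phi> i))" by (simp add: a_def)
      \<comment> \<open>The single \<open>1\<close> is at most \<open>I\<close>, the total
        contributed by the constant \<open>1\<close> in each of the \<open>I\<close> terms
        \<open>a i\<close>.\<close>
      also have "\<dots> \<le> I + fact w * (\<Sum>i<I. g (\<phi> i))" using I m_ge by simp
      also have "\<dots> = (\<Sum>i<I. 1 + fact w * g (\<phi> i))" unfolding sum.distrib by (simp add: sum_distrib_left)
      also have "\<dots> \<le> (\<Sum>i<I. a i)" by (intro sum_mono) (simp add: a_def)
      finally show "a m \<le> (\<Sum>i<I. a i)" .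
    qed
  qed
qed

lemma eps_complete_range_a: "eps_complete \<epsilon> (range a)"
  using eps_complete_block_sequence[OF eps(1) a_strict_mono a_pos w fact_gt_zero a_block a_coprime a_le_sum]
  by blast

end

text \<open>Because \<open>M\<close> is the same for every fixed shift \<open>k\<close>, a diagonal
  function can take the place of \<open>k\<close>; carrying \<open>k * k \<le> n\<close> along
  yields \<open>d_square\<close>.\<close>

lemma (in fractional_sum_sequence) block_construction_exists:
  "\<exists>M d w. block_construction \<epsilon> f N M d w"
proof -
  obtain M where M: "M > 0" "\<And>k. \<forall>\<^sub>F y in sequentially. real (f (y + k)) \<le> M * real (f y)"
    using f_shift_le_uniform by blast
  have "\<forall>\<^sub>F n in sequentially. real (f (n + k)) \<le> M * real (f n) \<and> k * k \<le> n" for k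
    using M(2)[of k] eventually_ge_at_top[of "k * k"] by (rule eventually_conj)
  then obtain d where d: "mono d" "\<And>k. \<forall>\<^sub>F n in sequentially. k \<le> d n"
    "\<forall>\<^sub>F n in sequentially. real (f (n + d n)) \<le> M * real (f n) \<and> d n * d n \<le> n"
    "\<And>\<delta>::real. \<delta> > 0 \<Longrightarrow> \<forall>\<^sub>F n in sequentially. d n \<le> Suc (d (nat \<lfloor>\<delta> * real n\<rfloor>))"
    using slow_function_exists[of "\<lambda>k n. real (f (n + k)) \<le> M * real (f n) \<and> k * k \<le> n"] by blast
  obtain w :: nat where "1 / \<epsilon> < real w" using reals_Archimedean2 by blast
  then have "\<epsilon> * real w > 1" using eps by (simp add: field_simps)
  then have "block_construction \<epsilon> f N M d w"
    by unfold_locales (use M d in \<open>auto simp: eventually_conj_iff\<close>)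
  then show ?thesis by blast
qed

section \<open>Enumeration and the combination of both bounds\<close>

lemma enumerate_range_strict_mono:
  fixes a :: "nat \<Rightarrow> nat"
  assumes "strict_mono a"
  shows "enumerate (range a) = a"
proof -
  have inf: "infinite (range a)" using assms by (simp add: range_inj_infinite strict_mono_imp_inj_on)
  show ?thesis
  proof
    fix n
    show "enumerate (range a) n = a n"
    proof (induction n)
      case 0
      show ?case unfolding enumerate_0
        using assms by (intro Least_equality) (auto simp: strict_mono_less_eq)
    next
      case (Suc n)
      show ?case unfolding enumerate_Suc''[OF inf] Suc
        using assms by (intro Least_equality) (auto simp: strict_mono_less strict_mono_less_eq)
    qed
  qed
qed

theorem theorem1p3:
  fixes \<epsilon> :: real and f :: "nat \<Rightarrow> nat"
  assumes "0 < \<epsilon>" "\<epsilon> < 1"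
    and "\<forall>n\<ge>1. f n > 0"
    and "\<exists>N. \<forall>n\<ge>N. f n = (\<Sum>i\<in>{1..nat \<lfloor>\<epsilon> * real n\<rfloor>}. f i)"
  shows "(\<forall>A. A \<subseteq> {1..} \<and> eps_complete \<epsilon> A \<longrightarrow>
            (\<lambda>n. real (enumerate A n)) \<in> O(\<lambda>n. real (f (Suc n))))
       \<and> (\<exists>A. A \<subseteq> {1..} \<and> eps_complete \<epsilon> A \<and>
            (\<lambda>n. real (enumerate A n)) \<in> \<Theta>(\<lambda>n. real (f (Suc n))))"
proof -
  obtain N where N: "\<forall>n\<ge>N. f n = (\<Sum>i\<in>{1..nat \<lfloor>\<epsilon> * real n\<rfloor>}. f i)" using assms(4) by blast
  interpret fractional_sum_sequence \<epsilon> f N by unfold_locales (use assms N in auto)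
  show ?thesis
  proof (intro conjI allI impI)
    fix A assume A: "A \<subseteq> {1..} \<and> eps_complete \<epsilon> A"
    then have inf: "infinite A" using eps_complete_imp_infinite assms(2) by blast
    have "strict_mono (enumerate A)" using inf by (rule strict_mono_enumerate)
    moreover have "enumerate A i \<ge> 1" for i using enumerate_in_set[OF inf, of i] A by auto
    moreover have "eps_complete \<epsilon> (range (enumerate A))" using A inf by (simp add: range_enumerate)
    ultimately obtain C n0 where
      "\<forall>n\<ge>n0. enumerate A n \<le> (\<Sum>i<nat \<lceil>\<epsilon> * real n\<rceil> + C. enumerate A i)"
      using eps_complete_imp_term_le_sum[OF assms(1,2)] by blast
    then show "(\<lambda>n. real (enumerate A n)) \<in> O(\<lambda>n. real (f (Suc n)))" by (rule bigo_if_term_le_sum)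
  next
    obtain M d w where "block_construction \<epsilon> f N M d w" using block_construction_exists by blast
    then interpret block_construction \<epsilon> f N M d w .
    have "range a \<subseteq> {1..}" using a_pos by auto
    then show "\<exists>A. A \<subseteq> {1..} \<and> eps_complete \<epsilon> A \<and>
        (\<lambda>n. real (enumerate A n)) \<in> \<Theta>(\<lambda>n. real (f (Suc n)))"
      using eps_complete_range_a a_bigtheta
      by (intro exI[of _ "range a"]) (simp add: enumerate_range_strict_mono[OF a_strict_mono])
  qed
qed

end
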